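(* Let $\mathcal{S}=((X,d),(f_i)_{i\in I})$ be a diameter diminishing to zero iterated function system. Then for every $\omega\in\Lambda(I)$ there exists $a_\omega\in X$ such that $$\bigcap_{n\in\mathbb{N}^*}\overline{f_{[\omega]_n}(B)}=\{a_\omega\}$$ for every $B\in P_{b,cl}(X)$ having the property that $F_{\mathcal{S}}(B)\subseteq B$.
   Context: Metric spaces are nonempty. For a metric space $(X,d)$, $P_b(X)$ is the set of nonempty bounded subsets of $X$ and $P_{b,cl}(X)$ the set of nonempty bounded closed subsets. An iterated function system (IFS) is a pair $\mathcal{S}=((X,d),(f_i)_{i\in I})$ where $(X,d)$ is a complete metric space, $I$ is a nonempty finite set, each $f_i:X\to X$ is continuous, and $f_i(B)\in P_b(X)$ for every $B\in P_b(X)$ and $i\in I$. Its fractal operator $F_{\mathcal{S}}:P_{b,cl}(X)\to P_{b,cl}(X)$ is $F_{\mathcal{S}}(B)=\overline{\bigcup_{i\in I}f_i(B)}$. $\mathbb{N}^*=\{1,2,\dots\}$. $\Lambda(I)=I^{\mathbb{N}^*}$ is the set of infinite words $\omega=\omega_1\omega_2\dots$ over $I$; $\Lambda_n(I)$ is the set of words of length $n$ over $I$; $[\omega]_n=\omega_1\dots\omega_n$ for $\omega\in\Lambda(I)$; $f_\omega=f_{\omega_1}\circ\dots\circ f_{\omega_n}$ for $\omega=\omega_1\dots\omega_n\in\Lambda_n(I)$. An IFS $\mathcal{S}$ is diameter diminishing to zero if for every $B\in P_{b,cl}(X)$ there exists $M_B\in P_{b,cl}(X)$ such that $B\subseteq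 M_B$, $F_{\mathcal{S}}(M_B)\subseteq M_B$ and $\lim_{n\to\infty}\max_{\omega\in\Lambda_n(I)}\mathrm{diam}(f_\omega(M_B))=0$. *)

theory Defs
  imports "HOL-Analysis.Analysis" "HOL-Library.Stream"
begin

definition Pb :: "'a::metric_space set set" where
  "Pb = {B. B \<noteq> {} \<and> bounded B}"

definition Pbcl :: "'a::metric_space set set" where
  "Pbcl = {B. B \<noteq> {} \<and> bounded B \<and> closed B}"

text \<open>The complete metric space \<open>X\<close> is the whole type \<open>'a\<close>, so its nonemptiness is automatic.
  The maps are given on the whole index type, but only the \<open>f i\<close> with \<open>i \<in> I\<close> matter.\<close>

definition IFS :: "'i set \<Rightarrow> ('i \<Rightarrow> 'a \<Rightarrow> 'a::complete_space) \<Rightarrow> bool" where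
  "IFS I f \<longleftrightarrow> finite I \<and> I \<noteq> {} \<and>
     (\<forall>i\<in>I. continuous_on UNIV (f i)) \<and> (\<forall>i\<in>I. \<forall>B\<in>Pb. f i ` B \<in> Pb)"

definition fractal_op ::
    "'i set \<Rightarrow> ('i \<Rightarrow> 'a \<Rightarrow> 'a::complete_space) \<Rightarrow> 'a set \<Rightarrow> 'a set" where
  "fractal_op I f B = closure (\<Union>i\<in>I. f i ` B)"

text \<open>Finite words are lists. Infinite words are streams: \<open>\<Lambda>(I)\<close> is \<^term>\<open>streams I\<close>, and
  the prefix \<open>[\<omega>]\<^sub>n\<close> is \<^term>\<open>stake n \<omega>\<close>.\<close>

definition words :: "'i set \<Rightarrow> nat \<Rightarrow> 'i list set" where
  "words I n = {w. set w \<subseteq> I \<and> length w = n}"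

primrec word_map :: "('i \<Rightarrow> 'a \<Rightarrow> 'a) \<Rightarrow> 'i list \<Rightarrow> 'a \<Rightarrow> 'a" where
  "word_map f [] = id"
| "word_map f (i # w) = f i \<circ> word_map f w"

text \<open>For an IFS the maximum is over a finite nonempty set, and all diameters are of nonempty
  bounded sets, so \<^const>\<open>Max\<close> and \<^const>\<open>diameter\<close> have their usual meaning.\<close>

definition diam_diminishing :: "'i set \<Rightarrow> ('i \<Rightarrow> 'a \<Rightarrow> 'a::complete_space) \<Rightarrow> bool" where
  "diam_diminishing I f \<longleftrightarrow>
     (\<forall>B\<in>Pbcl. \<exists>M\<in>Pbcl. B \<subseteq> M \<and> fractal_op I f M \<subseteq> M \<and>
        (\<lambda>n. Max ((\<lambda>w. diameter (word_map f w ` M)) ` words I n)) \<longlonglongrightarrow> 0)"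

end

theory Submission
  imports Defs
begin

text \<open>Fix a word \<open>\<omega>\<close>. Call \<open>B\<close> invariant if it is nonempty, bounded and closed and every \<open>f\<^sub>i\<close>
  maps it into itself. Then the sets \<open>f\<^bsub>[\<omega>]\<^sub>n\<^esub>(B)\<close> are nested, because the
  \<open>n+1\<close>-st map is applied first and sends \<open>B\<close> into itself. Their diameters are dominated by those of
  \<open>f\<^bsub>[\<omega>]\<^sub>n\<^esub>(M)\<close>, where \<open>M \<supseteq> B\<close> comes from the diminishing property, and so tend to \<open>0\<close>. Cantor's
  intersection theorem then gives exactly one point in the intersection of the closures
  (\<open>ex_Inter_closure_word_map_eq_singleton\<close>).

  The point does not depend on \<open>B\<close>: if \<open>B\<close> and \<open>B'\<close> are invariant, so is \<open>B \<union> B'\<close>, and the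
  singleton for \<open>B \<union> B'\<close> contains, by monotonicity, the singletons for \<open>B\<close> and for \<open>B'\<close>.\<close>

lemma fractal_op_subset_iff:
  assumes "closed B"
  shows "fractal_op I f B \<subseteq> B \<longleftrightarrow> (\<forall>i\<in>I. f i ` B \<subseteq> B)"
proof -
  have "fractal_op I f B \<subseteq> B \<longleftrightarrow> (\<Union>i\<in>I. f i ` B) \<subseteq> B"
    unfolding fractal_op_def using closure_minimal[OF _ assms] closure_subset subset_trans by metis
  then show ?thesis
    by (simp add: UN_subset_iff)
qed

lemma word_map_snoc: "word_map f (w @ [i]) = word_map f w \<circ> f i"
  by (induction w) (simp_all add: comp_assoc)

lemma word_map_image_subset:
  assumes "\<forall>i\<in>I. f i ` B \<subseteq> B" and "set w \<subseteq> I"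
  shows "word_map f w ` B \<subseteq> B"
  using assms(2)
proof (induction w)
  case Nil
  show ?case by simp
next
  case (Cons i w)
  then have "word_map f w ` B \<subseteq> B" and "f i ` B \<subseteq> B"
    using assms(1) by auto
  then show ?case
    by (auto simp: image_subset_iff)
qed

lemma stake_in_words:
  assumes "\<omega> \<in> streams I"
  shows "stake n \<omega> \<in> words I n"
proof -
  have "set (stake n \<omega>) \<subseteq> I"
    using assms by (induction n) (simp_all add: stake_Suc streams_iff_snth del: stake.simps(2))
  then show ?thesis
    by (simp add: words_def)
qed

lemma finite_words: "finite I \<Longrightarrow> finite (words I n)"
  unfolding words_def by (rule finite_lists_length_eq)

text \<open>The set \<open>B\<close> inherits shrinking diameters from an invariant \<open>M \<supseteq> B\<close>; invariance keeps each
  \<open>f\<^sub>w(M)\<close> inside \<open>M\<close>, hence bounded, so that its diameter is a true bound. The distance between two points of \<open>f\<^sub>w(B)\<close> is at most the diameter of \<open>f\<^sub>w(M)\<close>, and taking closures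
  does not change diameters. The bound is uniform over all words of a given length.\<close>

lemma dist_closure_word_map_small:
  assumes "IFS I f" and "diam_diminishing I f" and "B \<in> Pbcl" and "e > 0"
  shows "\<exists>N. \<forall>n\<ge>N. \<forall>w\<in>words I n. \<forall>x\<in>closure (word_map f w ` B). \<forall>y\<in>closure (word_map f w ` B).
    dist x y < e"
proof -
  let ?D = "\<lambda>M w. diameter (word_map f w ` M)"
  have fin: "finite I"
    using assms(1) by (simp add: IFS_def)
  obtain M where M: "M \<in> Pbcl" "B \<subseteq> M" "fractal_op I f M \<subseteq> M"
    and lim: "(\<lambda>n. Max (?D M ` words I n)) \<longlonglongrightarrow> 0"
    using assms(2,3) unfolding diam_diminishing_def by blast
  have inv: "\<forall>i\<in>I. f i ` M \<subseteq> M"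
    using M by (simp add: fractal_op_subset_iff Pbcl_def)
  obtain N where N: "\<And>n. n \<ge> N \<Longrightarrow> Max (?D M ` words I n) < e"
    using order_tendstoD(2)[OF lim \<open>e > 0\<close>] by (auto simp: eventually_sequentially)
  show ?thesis
  proof (intro exI[of _ N] allI impI ballI)
    fix n w x y
    assume "n \<ge> N" and w: "w \<in> words I n"
      and xy: "x \<in> closure (word_map f w ` B)" "y \<in> closure (word_map f w ` B)"
    have "word_map f w ` M \<subseteq> M"
      using inv w by (intro word_map_image_subset[of I]) (auto simp: words_def)
    then have bdd: "bounded (word_map f w ` M)"
      using M(1) bounded_subset by (auto simp: Pbcl_def)
    have "closure (word_map f w ` B) \<subseteq> closure (word_map f w ` M)"
      using M(2) by (intro closure_mono image_mono)
    then have "dist x y \<le> diameter (closure (word_map f w ` M))"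
      using xy bdd by (intro diameter_bounded_bound) auto
    also have "\<dots> = ?D M w"
      using bdd by (rule diameter_closure)
    also have "\<dots> \<le> Max (?D M ` words I n)"
      using w finite_words[OF fin] by (intro Max_ge) auto
    also have "\<dots> < e"
      using N \<open>n \<ge> N\<close> .
    finally show "dist x y < e" .
  qed
qed

lemma ex_Inter_closure_word_map_eq_singleton:
  assumes "IFS I f" and "diam_diminishing I f" and "\<omega> \<in> streams I"
    and "B \<in> Pbcl" and "fractal_op I f B \<subseteq> B"
  shows "\<exists>a. (\<Inter>n\<in>{1..}. closure (word_map f (stake n \<omega>) ` B)) = {a}"
proof -
  define S where "S n = closure (word_map f (stake (Suc n) \<omega>) ` B)" for n
  have inv: "\<forall>i\<in>I. f i ` B \<subseteq> B"
    using assms(4,5) by (simp add: fractal_op_subset_iff Pbcl_def)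
  have step: "S (Suc n) \<subseteq> S n" for n
  proof -
    have "f (\<omega> !! Suc n) ` B \<subseteq> B"
      using inv snth_in[OF assms(3)] by blast
    then have "word_map f (stake (Suc (Suc n)) \<omega>) ` B \<subseteq> word_map f (stake (Suc n) \<omega>) ` B"
      unfolding stake_Suc[of "Suc n"] word_map_snoc image_comp[symmetric] by (rule image_mono)
    then show ?thesis
      unfolding S_def by (rule closure_mono)
  qed
  have "\<exists>a. \<Inter>(range S) = {a}"
  proof (rule decreasing_closed_nest_sing)
    show "closed (S n)" for n
      by (simp add: S_def)
    show "S n \<noteq> {}" for n
      using assms(4) by (simp add: S_def Pbcl_def)
    show "S n \<subseteq> S m" if "m \<le> n" for m n
      using lift_Suc_antimono_le[of S] step that by blast
    show "\<exists>n. \<forall>x\<in>S n. \<forall>y\<in>S n. dist x y < e" if "e > 0" for e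
    proof -
      obtain N where N: "\<forall>n\<ge>N. \<forall>w\<in>words I n. \<forall>x\<in>closure (word_map f w ` B).
          \<forall>y\<in>closure (word_map f w ` B). dist x y < e"
        using dist_closure_word_map_small[OF assms(1,2,4) \<open>e > 0\<close>] ..
      have "\<forall>x\<in>S N. \<forall>y\<in>S N. dist x y < e"
        using N[THEN spec, THEN mp, THEN bspec, OF le_SucI[OF order_refl]
            stake_in_words[OF assms(3)]] unfolding S_def .
      then show ?thesis ..
    qed
  qed
  moreover have "{1..} = range Suc"
    using Suc_le_D by fastforce
  ultimately show ?thesis
    by (simp add: S_def image_image)
qed

theorem proposition3p1:
  fixes I :: "'i set" and f :: "'i \<Rightarrow> 'a \<Rightarrow> 'a::complete_space"
  assumes "IFS I f"
    and "diam_diminishing I f"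
  shows "\<forall>\<omega>\<in>streams I. \<exists>a. \<forall>B\<in>Pbcl. fractal_op I f B \<subseteq> B \<longrightarrow>
           (\<Inter>n\<in>{1..}. closure (word_map f (stake n \<omega>) ` B)) = {a}"
proof
  fix \<omega> assume \<omega>: "\<omega> \<in> streams I"
  define L where "L B = (\<Inter>n\<in>{1..}. closure (word_map f (stake n \<omega>) ` B))" for B
  define A where "A = {B \<in> Pbcl. fractal_op I f B \<subseteq> B}"
  have single: "\<exists>a. L B = {a}" if "B \<in> A" for B
    using ex_Inter_closure_word_map_eq_singleton[OF assms \<omega>] that by (simp add: L_def A_def)
  have L_mono: "L B \<subseteq> L C" if "B \<subseteq> C" for B C
    unfolding L_def using that by (intro INF_mono') (intro closure_mono image_mono)
  have A_Un: "B \<union> C \<in> A" if "B \<in> A" "C \<in> A" for B C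
  proof -
    have BC: "closed B" "closed C" "B \<union> C \<in> Pbcl"
      using that by (auto simp: A_def Pbcl_def)
    then have "\<forall>i\<in>I. f i ` B \<subseteq> B" "\<forall>i\<in>I. f i ` C \<subseteq> C"
      using that by (simp_all add: A_def fractal_op_subset_iff)
    then have "\<forall>i\<in>I. f i ` (B \<union> C) \<subseteq> B \<union> C"
      by blast
    then show ?thesis
      using BC by (simp add: A_def fractal_op_subset_iff closed_Un)
  qed
  have L_eq: "L B = L C" if "B \<in> A" "C \<in> A" for B C
  proof -
    have "\<exists>a. L B = {a}" "\<exists>b. L C = {b}" "\<exists>c. L (B \<union> C) = {c}"
      using that by (simp_all add: single A_Un)
    then obtain a b c where "L B = {a}" "L C = {b}" "L (B \<union> C) = {c}"
      by blast
    then show ?thesis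
      using L_mono[of B "B \<union> C"] L_mono[of C "B \<union> C"] by simp
  qed
  \<comment> \<open>For \<open>A = {}\<close> any point serves as \<open>a\<close>.\<close>
  have "\<exists>a. \<forall>B\<in>A. L B = {a}"
    using single L_eq by metis
  then show "\<exists>a. \<forall>B\<in>Pbcl. fractal_op I f B \<subseteq> B \<longrightarrow>
      (\<Inter>n\<in>{1..}. closure (word_map f (stake n \<omega>) ` B)) = {a}"
    by (auto simp: A_def L_def)
qed

end
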